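(* Assume the self-similar set $K$ is connected and that there exists $\beta>\alpha$ such that $\mathcal D_K^{(\beta)}$ contains nonconstant functions. Then $\beta_2^*=\beta_3^*$.
   Context: Let $\{S_i\}_{i=1}^N$ ($N\ge2$) be contractive similitudes of $\mathbb R^d$ with ratios $r_i\in(0,1)$ satisfying the open set condition; $K$ is the self-similar set, $\alpha$ its Hausdorff dimension ($\sum_i r_i^\alpha=1$), $\nu$ the normalized $\alpha$-dimensional Hausdorff measure on $K$, $r=\min_ir_i$. For $\beta>0$ let $\mathcal D_K^{(\beta)}$ be the Besov space $\Lambda^{\alpha,\beta/2}_{2,2}=\{u\in L^2(K,\nu):\iint_{K\times K}|u(\xi)-u(\eta)|^2|\xi-\eta|^{-(\alpha+\beta)}d\nu(\xi)d\nu(\eta)<\infty\}$ (it is the domain of the energy form induced on $K$ by the $\lambda$-natural random walk on the augmented tree of $K$, with $\lambda=r^\beta$). Define $\beta_2^*=\sup\{\beta>0:\dim\mathcal D_K^{(\beta)}=\infty\}$ and $\beta_3^*=\sup\{\beta>0:\mathcal D_K^{(\beta)}$ contains nonconstant functions$\}$. *)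

theory Defs
  imports "HOL-Analysis.Analysis" "HOL-Probability.Probability"
begin

definition similitude :: "('a::metric_space \<Rightarrow> 'a) \<Rightarrow> real \<Rightarrow> bool" where
  "similitude S \<rho> \<longleftrightarrow> (\<forall>x y. dist (S x) (S y) = \<rho> * dist x y)"

definition open_set_condition :: "nat \<Rightarrow> (nat \<Rightarrow> 'a::metric_space \<Rightarrow> 'a) \<Rightarrow> bool" where
  "open_set_condition N S \<longleftrightarrow>
     (\<exists>V. open V \<and> bounded V \<and> V \<noteq> {} \<and> (\<forall>i<N. S i ` V \<subseteq> V) \<and>
          (\<forall>i<N. \<forall>j<N. i \<noteq> j \<longrightarrow> S i ` V \<inter> S j ` V = {}))"

definition self_similar_set :: "nat \<Rightarrow> (nat \<Rightarrow> 'a::metric_space \<Rightarrow> 'a) \<Rightarrow> 'a set \<Rightarrow> bool" where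
  "self_similar_set N S K \<longleftrightarrow> compact K \<and> K \<noteq> {} \<and> K = (\<Union>i<N. S i ` K)"

definition hausdorff_pre :: "real \<Rightarrow> real \<Rightarrow> 'a::metric_space set \<Rightarrow> ennreal" where
  "hausdorff_pre \<delta> s A =
     (INF C \<in> {C :: nat \<Rightarrow> 'a set. A \<subseteq> (\<Union>n. C n) \<and> (\<forall>n. bounded (C n) \<and> diameter (C n) \<le> \<delta>)}.
        (\<Sum>n. ennreal (diameter (C n) powr s)))"

definition hausdorff_outer :: "real \<Rightarrow> 'a::metric_space set \<Rightarrow> ennreal" where
  "hausdorff_outer s A = (SUP \<delta> \<in> {0<..}. hausdorff_pre \<delta> s A)"

definition normalized_hausdorff :: "real \<Rightarrow> 'a::metric_space set \<Rightarrow> 'a measure" where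
  "normalized_hausdorff s K =
     measure_of K (sets (restrict_space borel K)) (\<lambda>A. hausdorff_outer s A / hausdorff_outer s K)"

definition besov_space :: "'a::metric_space measure \<Rightarrow> real \<Rightarrow> real \<Rightarrow> ('a \<Rightarrow> real) set" where
  "besov_space \<nu> \<alpha> \<beta> =
     {u. u \<in> borel_measurable \<nu> \<and> integrable \<nu> (\<lambda>x. (u x)^2) \<and>
         (\<integral>\<^sup>+ x. (\<integral>\<^sup>+ y. ennreal ((u x - u y)^2 * dist x y powr (-(\<alpha> + \<beta>))) \<partial>\<nu>) \<partial>\<nu>) < \<infinity>}"

text \<open>The space D (a set of functions, considered modulo nu-a.e. equality) is infinite-dimensional:
  for every n it contains n elements linearly independent as elements of L^2(nu).\<close>
definition ae_infinite_dimensional :: "'a measure \<Rightarrow> ('a \<Rightarrow> real) set \<Rightarrow> bool" where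
  "ae_infinite_dimensional \<nu> D \<longleftrightarrow>
     (\<forall>n. \<exists>u :: nat \<Rightarrow> 'a \<Rightarrow> real. (\<forall>i<n. u i \<in> D) \<and>
        (\<forall>c :: nat \<Rightarrow> real. (AE x in \<nu>. (\<Sum>i<n. c i * u i x) = 0) \<longrightarrow> (\<forall>i<n. c i = 0)))"

definition ae_has_nonconstant :: "'a measure \<Rightarrow> ('a \<Rightarrow> real) set \<Rightarrow> bool" where
  "ae_has_nonconstant \<nu> D \<longleftrightarrow> (\<exists>u\<in>D. \<forall>c. \<not> (AE x in \<nu>. u x = c))"

definition beta2_star :: "'a::metric_space measure \<Rightarrow> real \<Rightarrow> ereal" where
  "beta2_star \<nu> \<alpha> = Sup (ereal ` {\<beta>. \<beta> > 0 \<and> ae_infinite_dimensional \<nu> (besov_space \<nu> \<alpha> \<beta>)})"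

definition beta3_star :: "'a::metric_space measure \<Rightarrow> real \<Rightarrow> ereal" where
  "beta3_star \<nu> \<alpha> = Sup (ereal ` {\<beta>. \<beta> > 0 \<and> ae_has_nonconstant \<nu> (besov_space \<nu> \<alpha> \<beta>)})"

end

theory Submission
  imports Defs "HOL-Real_Asymp.Real_Asymp"
begin

text \<open>Rescaling by the similitudes shows that a ball of small radius \<open>\<rho>\<close> around a point of \<open>K\<close>
  has mass at least \<open>c * \<rho> powr \<alpha>\<close>. Let \<open>\<beta> > \<alpha>\<close>, and let \<open>u\<close> have finite energy and no values
  strictly between \<open>s\<close> and \<open>t\<close>. Two neighbouring balls of radius \<open>\<rho>\<close>, one filled mostly by
  \<open>{u \<le> s}\<close> and the other mostly by \<open>{u \<ge> t}\<close>, would carry energy of order \<open>\<rho> powr (\<alpha> - \<beta>)\<close>,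
  which is unbounded as \<open>\<rho>\<close> tends to \<open>0\<close>; so, \<open>K\<close> being connected, one of the two phases dominates
  in all balls of a given small radius. The interaction of the dominant phase with the other one
  then costs \<open>\<rho> powr (-\<beta>)\<close> times the mass of the latter, which therefore vanishes. Hence the
  essential range of \<open>u\<close> is an interval. If it is not a single point, composing \<open>u\<close> with tent
  functions of disjoint supports, which does not increase the energy, gives arbitrarily many
  independent elements of the same Besov space.\<close>

section \<open>Hausdorff measure of self-similar sets\<close>

lemma similitude_id: "similitude (\<lambda>x. x) 1"
  by (simp add: similitude_def)

lemma similitude_comp:
  assumes "similitude f \<rho>" "similitude g \<sigma>"
  shows "similitude (\<lambda>x. f (g x)) (\<rho> * \<sigma>)"
  using assms by (simp add: similitude_def)

lemma
  fixes f :: "'a::metric_space \<Rightarrow> 'a"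
  assumes f: "similitude f \<rho>" and \<rho>: "0 < \<rho>" and C: "bounded C"
  shows bounded_vimage_similitude: "bounded (f -` C)"
    and diameter_vimage_similitude: "\<rho> * diameter (f -` C) \<le> diameter C"
proof -
  have dist_le: "dist x y \<le> diameter C / \<rho>" if "x \<in> f -` C" "y \<in> f -` C" for x y
    using diameter_bounded_bound[OF C, of "f x" "f y"] that f \<rho>
    by (simp add: similitude_def field_simps)
  show "bounded (f -` C)"
    using dist_le unfolding bounded_two_points by blast
  show "\<rho> * diameter (f -` C) \<le> diameter C"
  proof (cases "f -` C = {}")
    case True
    then show ?thesis using diameter_ge_0[OF C] by simp
  next
    case False
    then have "diameter (f -` C) = (SUP (x, y)\<in>(f -` C) \<times> (f -` C). dist x y)"
      by (simp add: diameter_def)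
    also have "\<dots> \<le> diameter C / \<rho>"
      using False dist_le by (auto intro!: cSUP_least)
    finally show ?thesis using \<rho> by (simp add: field_simps)
  qed
qed

lemma hausdorff_outer_mono:
  assumes "A \<subseteq> B"
  shows "hausdorff_outer s A \<le> hausdorff_outer s B"
  unfolding hausdorff_outer_def hausdorff_pre_def
  using order_trans[OF assms] by (intro SUP_mono' INF_superset_mono) auto

lemma hausdorff_pre_similitude_image_ge:
  fixes f :: "'a::metric_space \<Rightarrow> 'a"
  assumes f: "similitude f \<rho>" and \<rho>: "0 < \<rho>" and s: "0 \<le> s"
  shows "ennreal (\<rho> powr s) * hausdorff_pre \<delta> s A \<le> hausdorff_pre (\<rho> * \<delta>) s (f ` A)"
  unfolding hausdorff_pre_def[of "\<rho> * \<delta>"]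
proof (rule INF_greatest)
  fix C :: "nat \<Rightarrow> 'a set"
  assume "C \<in> {C. f ` A \<subseteq> (\<Union>n. C n) \<and> (\<forall>n. bounded (C n) \<and> diameter (C n) \<le> \<rho> * \<delta>)}"
  then have cover: "f ` A \<subseteq> (\<Union>n. C n)" and bounded: "\<And>n. bounded (C n)"
    and small: "\<And>n. diameter (C n) \<le> \<rho> * \<delta>" by auto
  note bounded' = bounded_vimage_similitude[OF f \<rho> bounded]
  note diameter' = diameter_vimage_similitude[OF f \<rho> bounded]
  have "diameter (f -` C n) \<le> \<delta>" for n
    using order_trans[OF diameter' small] \<rho> by simp
  moreover have "A \<subseteq> (\<Union>n. f -` C n)" using cover by blast
  ultimately have "hausdorff_pre \<delta> s A \<le> (\<Sum>n. ennreal (diameter (f -` C n) powr s))"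
    unfolding hausdorff_pre_def using bounded' by (intro INF_lower) auto
  then have "ennreal (\<rho> powr s) * hausdorff_pre \<delta> s A
      \<le> (\<Sum>n. ennreal (\<rho> powr s) * ennreal (diameter (f -` C n) powr s))"
    by (simp add: mult_left_mono)
  also have "\<dots> \<le> (\<Sum>n. ennreal (diameter (C n) powr s))"
  proof (rule suminf_le)
    fix n
    have "\<rho> powr s * diameter (f -` C n) powr s = (\<rho> * diameter (f -` C n)) powr s"
      using \<rho> diameter_ge_0[OF bounded'] by (simp add: powr_mult)
    also have "\<dots> \<le> diameter (C n) powr s"
      using \<rho> s diameter' diameter_ge_0[OF bounded'] by (intro powr_mono2) auto
    finally show "ennreal (\<rho> powr s) * ennreal (diameter (f -` C n) powr s)
        \<le> ennreal (diameter (C n) powr s)"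
      by (simp add: ennreal_mult[symmetric])
  qed auto
  finally show "ennreal (\<rho> powr s) * hausdorff_pre \<delta> s A
      \<le> (\<Sum>n. ennreal (diameter (C n) powr s))" .
qed

lemma hausdorff_outer_similitude_image_ge:
  fixes f :: "'a::metric_space \<Rightarrow> 'a"
  assumes "similitude f \<rho>" "0 < \<rho>" "0 \<le> s"
  shows "ennreal (\<rho> powr s) * hausdorff_outer s A \<le> hausdorff_outer s (f ` A)"
  unfolding hausdorff_outer_def SUP_mult_left_ennreal
proof (rule SUP_mono)
  fix \<delta> :: real assume "\<delta> \<in> {0<..}"
  then show "\<exists>\<delta>'\<in>{0<..}. ennreal (\<rho> powr s) * hausdorff_pre \<delta> s A \<le> hausdorff_pre \<delta>' s (f ` A)"
    using assms by (intro bexI[of _ "\<rho> * \<delta>"] hausdorff_pre_similitude_image_ge) auto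
qed

definition cylinder_at_scale :: "real \<Rightarrow> 'a::metric_space set \<Rightarrow> 'a \<Rightarrow> real \<Rightarrow> bool" where
  "cylinder_at_scale p K x \<kappa> \<longleftrightarrow>
     (\<exists>f \<tau>. similitude f \<tau> \<and> p * \<kappa> \<le> \<tau> \<and> \<tau> \<le> \<kappa> \<and> x \<in> f ` K \<and> f ` K \<subseteq> K)"

lemma cylinder_at_scale_of_ratio_power:
  fixes S :: "nat \<Rightarrow> 'a::metric_space \<Rightarrow> 'a"
  assumes S: "\<And>i. i < N \<Longrightarrow> similitude (S i) (r i)" and invariant: "K = (\<Union>i<N. S i ` K)"
    and p: "0 < p" "\<And>i. i < N \<Longrightarrow> p \<le> r i" and q: "q < 1" "\<And>i. i < N \<Longrightarrow> r i \<le> q"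
    and "x \<in> K" "q ^ n \<le> \<kappa>" "\<kappa> \<le> 1"
  shows "cylinder_at_scale p K x \<kappa>"
  using assms(7-9)
proof (induction n arbitrary: x \<kappa>)
  case 0
  then obtain i where i: "i < N" using invariant by blast
  have "p \<le> 1" using p(2)[OF i] q(1) q(2)[OF i] by linarith
  then show ?case
    unfolding cylinder_at_scale_def
    using 0 similitude_id by (intro exI[of _ "\<lambda>x. x"] exI[of _ 1]) auto
next
  case (Suc n)
  obtain i y where i: "i < N" and y: "y \<in> K" "x = S i y"
    using \<open>x \<in> K\<close> invariant by blast
  have r: "0 < r i" "r i \<le> q" using p(1) p(2)[OF i] q(2)[OF i] by linarith+
  have maps: "S i ` K \<subseteq> K" using i invariant by blast
  show ?case
  proof (cases "r i \<le> \<kappa>")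
    case True
    have "p * \<kappa> \<le> r i" using mult_mono[of p "r i" \<kappa> 1] p(2)[OF i] r Suc.prems True by simp
    then show ?thesis unfolding cylinder_at_scale_def using True S[OF i] maps y by blast
  next
    case False
    have "q ^ n * r i \<le> q ^ n * q" using r by (intro mult_left_mono) auto
    also have "\<dots> \<le> \<kappa>" using Suc.prems by (simp add: mult.commute)
    finally have "q ^ n \<le> \<kappa> / r i" using r by (simp add: pos_le_divide_eq)
    moreover have "\<kappa> / r i \<le> 1" using False r by simp
    ultimately obtain f \<tau> where "similitude f \<tau>" and \<tau>: "p * (\<kappa> / r i) \<le> \<tau>" "\<tau> \<le> \<kappa> / r i"
      and "y \<in> f ` K" "f ` K \<subseteq> K"
      using Suc.IH[OF y(1)] unfolding cylinder_at_scale_def by blast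
    moreover have "p * \<kappa> \<le> r i * \<tau>" "r i * \<tau> \<le> \<kappa>" using \<tau> r by (simp_all add: field_simps)
    ultimately show ?thesis
      unfolding cylinder_at_scale_def using similitude_comp[OF S[OF i]] maps y(2)
      by (intro exI[of _ "\<lambda>z. S i (f z)"] exI[of _ "r i * \<tau>"]) blast
  qed
qed

lemma self_similar_set_cylinder_at_scale:
  fixes S :: "nat \<Rightarrow> 'a::metric_space \<Rightarrow> 'a"
  assumes S: "\<forall>i<N. 0 < r i \<and> r i < 1 \<and> similitude (S i) (r i)" and K: "self_similar_set N S K"
  obtains p where "0 < p"
    and "\<And>x \<kappa>. x \<in> K \<Longrightarrow> 0 < \<kappa> \<Longrightarrow> \<kappa> \<le> 1 \<Longrightarrow> cylinder_at_scale p K x \<kappa>"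
proof -
  have invariant: "K = (\<Union>i<N. S i ` K)" and "K \<noteq> {}"
    using K by (simp_all add: self_similar_set_def)
  then have "{..<N} \<noteq> {}" by auto
  define p where "p = Min (r ` {..<N})"
  define q where "q = Max (r ` {..<N})"
  have "p \<in> r ` {..<N}" "q \<in> r ` {..<N}"
    using \<open>{..<N} \<noteq> {}\<close> by (auto simp: p_def q_def intro!: Min_in Max_in)
  then have p: "0 < p" and q: "q < 1" using S by auto
  have ratio: "p \<le> r i" "r i \<le> q" if "i < N" for i
    using that by (auto simp: p_def q_def)
  show ?thesis
  proof (rule that[OF p])
    fix x and \<kappa> :: real assume x: "x \<in> K" and \<kappa>: "0 < \<kappa>" "\<kappa> \<le> 1"
    obtain n where n: "q ^ n < \<kappa>" using real_arch_pow_inv[OF \<kappa>(1) q] by blast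
    have "similitude (S i) (r i)" if "i < N" for i using S that by blast
    then show "cylinder_at_scale p K x \<kappa>"
      by (rule cylinder_at_scale_of_ratio_power
          [OF _ invariant p ratio(1) q ratio(2) x less_imp_le[OF n] \<kappa>(2)])
  qed
qed

lemma similitude_image_subset_ball:
  fixes f :: "'a::metric_space \<Rightarrow> 'a"
  assumes f: "similitude f \<tau>" "0 \<le> \<tau>" and K: "bounded K" "y \<in> K" and small: "\<tau> * diameter K < \<rho>"
  shows "f ` K \<subseteq> ball (f y) \<rho>"
proof -
  have "dist (f y) (f z) < \<rho>" if "z \<in> K" for z
    using mult_left_mono[OF diameter_bounded_bound[OF K that] f(2)] f(1) small
    by (simp add: similitude_def)
  then show ?thesis by auto
qed

lemma hausdorff_outer_self_similar_ball_ge: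
  fixes S :: "nat \<Rightarrow> 'a::metric_space \<Rightarrow> 'a"
  assumes S: "\<forall>i<N. 0 < r i \<and> r i < 1 \<and> similitude (S i) (r i)"
    and K: "self_similar_set N S K" and s: "0 \<le> s"
  obtains c D where "0 < c" "0 < D"
    and "\<And>x \<rho>. x \<in> K \<Longrightarrow> 0 < \<rho> \<Longrightarrow> \<rho> \<le> D \<Longrightarrow>
           ennreal (c * \<rho> powr s) * hausdorff_outer s K \<le> hausdorff_outer s (K \<inter> ball x \<rho>)"
proof -
  obtain p where p: "0 < p"
    and cylinder: "\<And>x \<kappa>. x \<in> K \<Longrightarrow> 0 < \<kappa> \<Longrightarrow> \<kappa> \<le> 1 \<Longrightarrow> cylinder_at_scale p K x \<kappa>"
    using self_similar_set_cylinder_at_scale[OF S K] by blast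
  have bounded: "bounded K" using K by (auto simp: self_similar_set_def compact_imp_bounded)
  define D where "D = diameter K + 1"
  have D: "0 < D" using diameter_ge_0[OF bounded] by (simp add: D_def)
  have "ennreal ((p / D) powr s * \<rho> powr s) * hausdorff_outer s K
      \<le> hausdorff_outer s (K \<inter> ball x \<rho>)" if x: "x \<in> K" and \<rho>: "0 < \<rho>" "\<rho> \<le> D" for x \<rho>
  proof -
    have "0 < \<rho> / D" "\<rho> / D \<le> 1" using \<rho> D by simp_all
    from cylinder[OF x this, unfolded cylinder_at_scale_def] obtain f \<tau> y
      where f: "similitude f \<tau>" and \<tau>: "p * (\<rho> / D) \<le> \<tau>" "\<tau> \<le> \<rho> / D"
      and y: "y \<in> K" "x = f y" and maps: "f ` K \<subseteq> K" by blast
    have \<tau>_pos: "0 < \<tau>" using mult_pos_pos[OF p \<open>0 < \<rho> / D\<close>] \<tau>(1) by linarith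
    have "\<tau> * diameter K < \<tau> * D" using \<tau>_pos by (simp add: D_def)
    also have "\<dots> \<le> \<rho>" using \<tau>(2) D by (simp add: field_simps)
    finally have inside: "f ` K \<subseteq> K \<inter> ball x \<rho>"
      using similitude_image_subset_ball[OF f less_imp_le[OF \<tau>_pos] bounded y(1)] maps y(2) by blast
    have "(p / D) powr s * \<rho> powr s = (p * (\<rho> / D)) powr s"
      using p D \<rho> by (simp add: powr_mult[symmetric])
    also have "\<dots> \<le> \<tau> powr s" using s p D \<rho> \<tau> by (intro powr_mono2) auto
    finally have "ennreal ((p / D) powr s * \<rho> powr s) * hausdorff_outer s K
        \<le> ennreal (\<tau> powr s) * hausdorff_outer s K"
      by (intro mult_right_mono ennreal_leI) auto
    also have "\<dots> \<le> hausdorff_outer s (f ` K)"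
      by (rule hausdorff_outer_similitude_image_ge[OF f \<tau>_pos s])
    also have "\<dots> \<le> hausdorff_outer s (K \<inter> ball x \<rho>)" by (rule hausdorff_outer_mono[OF inside])
    finally show ?thesis .
  qed
  then show ?thesis using that[of "(p / D) powr s" D] p D by simp
qed

lemma sets_restrict_borel_subset_Pow: "sets (restrict_space borel K) \<subseteq> Pow K"
  using sets.space_closed[of "restrict_space borel K"] by (simp add: space_restrict_space)

lemma space_normalized_hausdorff: "space (normalized_hausdorff s K) = K"
  and sets_normalized_hausdorff: "sets (normalized_hausdorff s K) = sets (restrict_space borel K)"
proof -
  show "space (normalized_hausdorff s K) = K"
    using sets_restrict_borel_subset_Pow[of K]
    by (simp add: normalized_hausdorff_def space_measure_of)
  show "sets (normalized_hausdorff s K) = sets (restrict_space borel K)"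
    using sets_restrict_borel_subset_Pow[of K] sets.sigma_sets_eq[of "restrict_space borel K"]
    by (simp add: normalized_hausdorff_def sets_measure_of space_restrict_space)
qed

text \<open>Since \<open>measure_of\<close> yields the null measure when its argument is not a measure, and division of
  \<open>0\<close> or \<open>\<infinity>\<close> by itself yields \<open>0\<close> as well, a nonzero total mass already certifies that the
  Hausdorff measure is a measure on \<open>K\<close> and is positive and finite there.\<close>

lemma emeasure_normalized_hausdorff:
  assumes "emeasure (normalized_hausdorff s K) K \<noteq> 0" "A \<in> sets (normalized_hausdorff s K)"
  shows "emeasure (normalized_hausdorff s K) A = hausdorff_outer s A / hausdorff_outer s K"
  using assms sets_restrict_borel_subset_Pow[of K]
  by (auto simp: normalized_hausdorff_def emeasure_measure_of_conv split: if_splits)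

lemma hausdorff_outer_pos_finite:
  assumes "emeasure (normalized_hausdorff s K) K \<noteq> 0"
  shows "hausdorff_outer s K \<noteq> 0" "hausdorff_outer s K \<noteq> \<infinity>"
  using emeasure_normalized_hausdorff[OF assms emeasure_neq_0_sets[OF assms]] assms by auto

lemma prob_space_normalized_hausdorff:
  assumes "emeasure (normalized_hausdorff s K) K \<noteq> 0"
  shows "prob_space (normalized_hausdorff s K)"
proof
  show "emeasure (normalized_hausdorff s K) (space (normalized_hausdorff s K)) = 1"
    using emeasure_normalized_hausdorff[OF assms emeasure_neq_0_sets[OF assms]]
      hausdorff_outer_pos_finite[OF assms]
    by (simp add: space_normalized_hausdorff ennreal_divide_self less_top)
qed

text \<open>Non-measurable sets have \<open>emeasure\<close> \<open>0\<close>, so the bound also makes the small balls measurable.\<close>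

definition lower_regular :: "'a::metric_space measure \<Rightarrow> real \<Rightarrow> bool" where
  "lower_regular M s \<longleftrightarrow> (\<exists>c>0. \<exists>D>0. \<forall>x\<in>space M. \<forall>\<rho>. 0 < \<rho> \<longrightarrow> \<rho> \<le> D \<longrightarrow>
     ennreal (c * \<rho> powr s) \<le> emeasure M (space M \<inter> ball x \<rho>))"

lemma lower_regular_normalized_hausdorff:
  fixes S :: "nat \<Rightarrow> 'a::metric_space \<Rightarrow> 'a"
  assumes "\<forall>i<N. 0 < r i \<and> r i < 1 \<and> similitude (S i) (r i)" "self_similar_set N S K" "0 \<le> s"
    and nonnull: "emeasure (normalized_hausdorff s K) K \<noteq> 0"
  shows "lower_regular (normalized_hausdorff s K) s"
proof -
  define H where "H = hausdorff_outer s K"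
  have H: "H \<noteq> 0" "H \<noteq> \<infinity>" using hausdorff_outer_pos_finite[OF nonnull] by (simp_all add: H_def)
  obtain c D where c: "0 < c" and D: "0 < D" and ball_ge: "\<And>x \<rho>. x \<in> K \<Longrightarrow> 0 < \<rho> \<Longrightarrow> \<rho> \<le> D \<Longrightarrow>
      ennreal (c * \<rho> powr s) * H \<le> hausdorff_outer s (K \<inter> ball x \<rho>)"
    using hausdorff_outer_self_similar_ball_ge[OF assms(1-3)] unfolding H_def by blast
  have "ennreal (c * \<rho> powr s) \<le> emeasure (normalized_hausdorff s K) (K \<inter> ball x \<rho>)"
    if "x \<in> K" "0 < \<rho>" "\<rho> \<le> D" for x \<rho>
  proof -
    have "ennreal (c * \<rho> powr s) = ennreal (c * \<rho> powr s) * H / H"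
      using H by (simp add: ennreal_mult_divide_eq)
    also have "\<dots> \<le> hausdorff_outer s (K \<inter> ball x \<rho>) / H"
      by (intro divide_right_mono_ennreal ball_ge that)
    also have "\<dots> = emeasure (normalized_hausdorff s K) (K \<inter> ball x \<rho>)"
      unfolding H_def by (rule emeasure_normalized_hausdorff[OF nonnull, symmetric])
        (auto simp: sets_normalized_hausdorff sets_restrict_space)
    finally show ?thesis .
  qed
  then show ?thesis
    unfolding lower_regular_def space_normalized_hausdorff using c D by blast
qed

section \<open>Essential range\<close>

definition essential_range :: "'a measure \<Rightarrow> ('a \<Rightarrow> 'b::topological_space) \<Rightarrow> 'b set" where
  "essential_range M u = {v. \<forall>U. open U \<longrightarrow> v \<in> U \<longrightarrow> \<not> (AE x in M. u x \<notin> U)}"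

lemma essential_rangeD:
  assumes "v \<in> essential_range M u" "open U" "v \<in> U"
  shows "\<not> (AE x in M. u x \<notin> U)"
  using assms by (simp add: essential_range_def)

lemma AE_in_essential_range:
  fixes u :: "'a \<Rightarrow> 'b::second_countable_topology"
  shows "AE x in M. u x \<in> essential_range M u"
proof -
  define \<U> where "\<U> = {U. open U \<and> (AE x in M. u x \<notin> U)}"
  obtain \<V> where \<V>: "\<V> \<subseteq> \<U>" "countable \<V>" "\<Union>\<V> = \<Union>\<U>"
    using Lindelof[of \<U>] by (auto simp: \<U>_def)
  have "AE x in M. \<forall>U\<in>\<V>. u x \<notin> U"
    using \<V>(1,2) by (subst AE_ball_countable) (auto simp: \<U>_def)
  then have "AE x in M. u x \<notin> \<Union>\<U>"
    by eventually_elim (simp flip: \<V>(3))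
  moreover have "essential_range M u = - \<Union>\<U>"
    by (auto simp: essential_range_def \<U>_def)
  ultimately show ?thesis by simp
qed

lemma nonconstant_imp_essential_range_distinct:
  fixes u :: "'a \<Rightarrow> 'b::second_countable_topology"
  assumes "\<forall>c. \<not> (AE x in M. u x = c)"
  obtains v w where "v \<in> essential_range M u" "w \<in> essential_range M u" "v \<noteq> w"
proof (rule ccontr)
  assume "\<not> thesis"
  with that obtain c where "essential_range M u \<subseteq> {c}" by blast
  then have "AE x in M. u x = c"
    using AE_in_essential_range[of u M] by (auto elim: eventually_mono)
  with assms show False by blast
qed

lemma is_interval_essential_range:
  fixes u :: "'a \<Rightarrow> real"
  assumes no_gap: "\<And>s t. s < t \<Longrightarrow> AE x in M. \<not> (s < u x \<and> u x < t) \<Longrightarrow>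
      (AE x in M. s < u x) \<or> (AE x in M. u x < t)"
  shows "is_interval (essential_range M u)"
  unfolding is_interval_1
proof (intro ballI allI impI)
  fix v w z
  assume v: "v \<in> essential_range M u" and w: "w \<in> essential_range M u" and z: "v \<le> z \<and> z \<le> w"
  show "z \<in> essential_range M u"
  proof (rule ccontr)
    assume z_notin: "z \<notin> essential_range M u"
    then have "v < z" "z < w" using v w z by (auto simp: less_le)
    obtain U where "open U" "z \<in> U" and null: "AE x in M. u x \<notin> U"
      using z_notin by (auto simp: essential_range_def)
    then obtain e where e: "0 < e" "ball z e \<subseteq> U" using open_contains_ball by blast
    define s where "s = max ((v + z) / 2) (z - e)"
    define t where "t = min ((z + w) / 2) (z + e)"
    have bounds: "v < s" "s < t" "t < w"
      using \<open>v < z\<close> \<open>z < w\<close> e(1) by (simp_all add: s_def t_def max_def min_def)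
    have "{s<..<t} \<subseteq> U" using e(2) by (force simp: s_def t_def dist_real_def)
    then have "AE x in M. \<not> (s < u x \<and> u x < t)"
      using null by (auto elim!: eventually_mono)
    with no_gap bounds consider "AE x in M. s < u x" | "AE x in M. u x < t" by blast
    then show False
    proof cases
      case 1
      then have "AE x in M. u x \<notin> {..<s}" by eventually_elim simp
      then show False using essential_rangeD[OF v, of "{..<s}"] bounds(1) by simp
    next
      case 2
      then have "AE x in M. u x \<notin> {t<..}" by eventually_elim simp
      then show False using essential_rangeD[OF w, of "{t<..}"] bounds(3) by simp
    qed
  qed
qed

section \<open>Finite energy excludes gaps\<close>

definition besov_energy :: "'a::metric_space measure \<Rightarrow> real \<Rightarrow> ('a \<Rightarrow> real) \<Rightarrow> ennreal" where
  "besov_energy M \<gamma> u = (\<integral>\<^sup>+ x. \<integral>\<^sup>+ y. ennreal ((u x - u y)\<^sup>2 * dist x y powr - \<gamma>) \<partial>M \<partial>M)"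

lemma mem_besov_space_iff:
  "u \<in> besov_space M \<alpha> \<beta> \<longleftrightarrow> u \<in> borel_measurable M \<and> integrable M (\<lambda>x. (u x)\<^sup>2) \<and>
     besov_energy M (\<alpha> + \<beta>) u < \<infinity>"
  by (simp add: besov_space_def besov_energy_def)

lemma besov_energy_ge:
  assumes X: "X \<in> sets M" and \<delta>: "0 < \<delta>" and \<gamma>: "0 \<le> \<gamma>"
    and h: "0 < h" and mass: "\<And>x. x \<in> X \<Longrightarrow> ennreal h \<le> emeasure M (Y x)"
    and jump: "\<And>x y. x \<in> X \<Longrightarrow> y \<in> Y x \<Longrightarrow> \<delta> \<le> \<bar>u x - u y\<bar>"
    and near: "\<And>x y. x \<in> X \<Longrightarrow> y \<in> Y x \<Longrightarrow> dist x y \<le> R"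
  shows "ennreal (\<delta>\<^sup>2 * R powr - \<gamma> * h) * emeasure M X \<le> besov_energy M \<gamma> u"
proof -
  define k where "k = \<delta>\<^sup>2 * R powr - \<gamma>"
  have k: "0 \<le> k" by (simp add: k_def)
  have inner: "ennreal (k * h) \<le> (\<integral>\<^sup>+ y. ennreal ((u x - u y)\<^sup>2 * dist x y powr - \<gamma>) \<partial>M)"
    if x: "x \<in> X" for x
  proof -
    have Y: "Y x \<in> sets M" using mass[OF x] h by (intro emeasure_neq_0_sets) auto
    have "k \<le> (u x - u y)\<^sup>2 * dist x y powr - \<gamma>" if y: "y \<in> Y x" for y
    proof -
      have "\<delta>\<^sup>2 \<le> (u x - u y)\<^sup>2"
        using jump[OF x y] \<delta> by (intro abs_le_square_iff[THEN iffD1]) simp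
      moreover have "R powr - \<gamma> \<le> dist x y powr - \<gamma>"
        using jump[OF x y] near[OF x y] \<delta> \<gamma> by (intro powr_mono2') auto
      ultimately show ?thesis unfolding k_def by (intro mult_mono) auto
    qed
    then have "(\<integral>\<^sup>+ y. ennreal k * indicator (Y x) y \<partial>M)
        \<le> (\<integral>\<^sup>+ y. ennreal ((u x - u y)\<^sup>2 * dist x y powr - \<gamma>) \<partial>M)"
      by (intro nn_integral_mono) (auto simp: indicator_def ennreal_leI)
    moreover have "ennreal (k * h) \<le> (\<integral>\<^sup>+ y. ennreal k * indicator (Y x) y \<partial>M)"
      using mass[OF x] Y k by (simp add: nn_integral_cmult_indicator ennreal_mult' mult_left_mono)
    ultimately show ?thesis by (rule order_trans[rotated])
  qed
  have "ennreal (k * h) * emeasure M X = (\<integral>\<^sup>+ x. ennreal (k * h) * indicator X x \<partial>M)"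
    using X by (simp add: nn_integral_cmult_indicator)
  also have "\<dots> \<le> besov_energy M \<gamma> u"
    unfolding besov_energy_def
    by (intro nn_integral_mono) (auto simp: indicator_def inner)
  finally show ?thesis by (simp add: k_def)
qed

lemma connected_near_invariant_all_or_none:
  fixes K :: "'a::metric_space set"
  assumes conn: "connected K" and \<rho>: "0 < \<rho>"
    and near: "\<And>x y. x \<in> K \<Longrightarrow> y \<in> K \<Longrightarrow> dist x y < \<rho> \<Longrightarrow> P x \<Longrightarrow> P y"
  shows "(\<forall>x\<in>K. P x) \<or> (\<forall>x\<in>K. \<not> P x)"
proof -
  have "P y" if "x \<in> K" "y \<in> K" "P x" for x y
  proof (rule connected_induction_simple[where P = P, OF conn that])
    fix a assume "a \<in> K"
    let ?T = "K \<inter> ball a (\<rho> / 2)"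
    have "P z" if "y \<in> ?T" "z \<in> ?T" "P y" for y z
      using near[of y z] dist_triangle_half_r[of a y \<rho> z] that by simp
    moreover have "openin (top_of_set K) ?T" by (intro openin_open_Int open_ball)
    moreover have "a \<in> ?T" using \<open>a \<in> K\<close> \<rho> by simp
    ultimately show "\<exists>T. openin (top_of_set K) T \<and> a \<in> T \<and> (\<forall>y\<in>T. \<forall>z\<in>T. P y \<longrightarrow> P z)"
      by blast
  qed
  then show ?thesis by blast
qed

lemma half_mass_in_one_part:
  assumes A: "A \<in> sets M" and B: "B \<in> sets M" and cover: "AE x in M. x \<in> A \<union> B"
    and h: "0 < h" and mass: "ennreal (2 * h) \<le> emeasure M W"
  shows "ennreal h \<le> emeasure M (A \<inter> W) \<or> ennreal h \<le> emeasure M (B \<inter> W)"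
proof (rule ccontr)
  assume "\<not> ?thesis"
  then have less: "emeasure M (A \<inter> W) < ennreal h" "emeasure M (B \<inter> W) < ennreal h" by auto
  have W: "W \<in> sets M" using mass h by (intro emeasure_neq_0_sets) auto
  have "ennreal (2 * h) \<le> emeasure M W" by (rule mass)
  also have "\<dots> \<le> emeasure M ((A \<inter> W) \<union> (B \<inter> W))"
    using cover A B W by (intro emeasure_mono_AE) (auto elim: eventually_mono)
  also have "\<dots> \<le> emeasure M (A \<inter> W) + emeasure M (B \<inter> W)"
    by (intro emeasure_subadditive sets.Int A B W)
  also have "\<dots> < ennreal h + ennreal h" by (intro add_strict_mono less)
  finally show False using h by (simp flip: ennreal_plus)
qed

definition dominates_balls :: "'a::metric_space measure \<Rightarrow> real \<Rightarrow> real \<Rightarrow> 'a set \<Rightarrow> bool" where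
  "dominates_balls M \<rho> h A \<longleftrightarrow> (\<forall>x\<in>space M. ennreal h \<le> emeasure M (A \<inter> ball x \<rho>))"

lemma connected_dominant_phase:
  fixes M :: "'a::metric_space measure"
  assumes conn: "connected (space M)" and \<rho>: "0 < \<rho>" and h: "0 < h"
    and A: "A \<in> sets M" and B: "B \<in> sets M" and cover: "AE x in M. x \<in> A \<union> B"
    and ball_ge: "\<And>x. x \<in> space M \<Longrightarrow> ennreal (2 * h) \<le> emeasure M (space M \<inter> ball x \<rho>)"
    and not_both: "\<And>x y. x \<in> space M \<Longrightarrow> y \<in> space M \<Longrightarrow> dist x y < \<rho> \<Longrightarrow>
      ennreal h \<le> emeasure M (A \<inter> ball x \<rho>) \<Longrightarrow> ennreal h \<le> emeasure M (B \<inter> ball y \<rho>) \<Longrightarrow> False"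
  shows "dominates_balls M \<rho> h A \<or> dominates_balls M \<rho> h B"
proof -
  have "Z \<inter> (space M \<inter> ball x \<rho>) = Z \<inter> ball x \<rho>" if "Z \<in> sets M" for Z x
    using sets.sets_into_space[OF that] by auto
  then have half: "ennreal h \<le> emeasure M (A \<inter> ball x \<rho>) \<or> ennreal h \<le> emeasure M (B \<inter> ball x \<rho>)"
    if "x \<in> space M" for x
    using half_mass_in_one_part[OF A B cover h ball_ge[OF that]] A B by simp
  have "(\<forall>x\<in>space M. ennreal h \<le> emeasure M (A \<inter> ball x \<rho>)) \<or>
      (\<forall>x\<in>space M. \<not> ennreal h \<le> emeasure M (A \<inter> ball x \<rho>))"
    using half not_both by (intro connected_near_invariant_all_or_none[OF conn \<rho>]) blast
  then show ?thesis using half unfolding dominates_balls_def by blast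
qed

lemma besov_energy_ge_adjacent_balls:
  assumes \<delta>: "0 < \<delta>" and jump: "\<And>a b. a \<in> A \<Longrightarrow> b \<in> B \<Longrightarrow> \<delta> \<le> \<bar>u a - u b\<bar>"
    and \<gamma>: "0 \<le> \<gamma>" and h: "0 < h" and xy: "dist x y < \<rho>"
    and A: "ennreal h \<le> emeasure M (A \<inter> ball x \<rho>)" and B: "ennreal h \<le> emeasure M (B \<inter> ball y \<rho>)"
  shows "ennreal (\<delta>\<^sup>2 * (3 * \<rho>) powr - \<gamma> * h\<^sup>2) \<le> besov_energy M \<gamma> u"
proof -
  have "dist a b \<le> 3 * \<rho>" if "dist x a < \<rho>" "dist y b < \<rho>" for a b
    using that xy dist_triangle[of a b x] dist_triangle[of x b y] by (simp add: dist_commute)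
  moreover have "A \<inter> ball x \<rho> \<in> sets M" using A h by (intro emeasure_neq_0_sets) auto
  ultimately have "ennreal (\<delta>\<^sup>2 * (3 * \<rho>) powr - \<gamma> * h) * emeasure M (A \<inter> ball x \<rho>)
      \<le> besov_energy M \<gamma> u"
    using jump B by (intro besov_energy_ge[OF _ \<delta> \<gamma> h, where Y = "\<lambda>_. B \<inter> ball y \<rho>"]) auto
  moreover have "ennreal (\<delta>\<^sup>2 * (3 * \<rho>) powr - \<gamma> * h\<^sup>2)
      = ennreal (\<delta>\<^sup>2 * (3 * \<rho>) powr - \<gamma> * h) * ennreal h"
    using h by (simp add: power2_eq_square mult.assoc flip: ennreal_mult'')
  ultimately show ?thesis using mult_left_mono[OF A] order_trans by fastforce
qed

lemma besov_energy_ge_dominant_phase: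
  assumes \<delta>: "0 < \<delta>" and jump: "\<And>a b. a \<in> A \<Longrightarrow> b \<in> B \<Longrightarrow> \<delta> \<le> \<bar>u a - u b\<bar>"
    and \<gamma>: "0 \<le> \<gamma>" and h: "0 < h" and B: "B \<in> sets M"
    and dominant: "dominates_balls M \<rho> h A"
  shows "ennreal (\<delta>\<^sup>2 * \<rho> powr - \<gamma> * h) * emeasure M B \<le> besov_energy M \<gamma> u"
proof (rule besov_energy_ge[OF B \<delta> \<gamma> h, where Y = "\<lambda>x. A \<inter> ball x \<rho>"])
  show "ennreal h \<le> emeasure M (A \<inter> ball x \<rho>)" if "x \<in> B" for x
    using dominant sets.sets_into_space[OF B] that unfolding dominates_balls_def by blast
  show "\<delta> \<le> \<bar>u x - u y\<bar>" if "x \<in> B" "y \<in> A \<inter> ball x \<rho>" for x y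
    using jump[of y x] that by (simp add: abs_minus_commute)
qed auto

lemma besov_energy_ge_two_phases:
  fixes M :: "'a::metric_space measure"
  assumes conn: "connected (space M)" and \<rho>: "0 < \<rho>" and h: "0 < h"
    and A: "A \<in> sets M" and B: "B \<in> sets M" and cover: "AE x in M. x \<in> A \<union> B"
    and ball_ge: "\<And>x. x \<in> space M \<Longrightarrow> ennreal (2 * h) \<le> emeasure M (space M \<inter> ball x \<rho>)"
    and \<delta>: "0 < \<delta>" and jump: "\<And>a b. a \<in> A \<Longrightarrow> b \<in> B \<Longrightarrow> \<delta> \<le> \<bar>u a - u b\<bar>"
    and \<gamma>: "0 \<le> \<gamma>" and small: "besov_energy M \<gamma> u < ennreal (\<delta>\<^sup>2 * (3 * \<rho>) powr - \<gamma> * h\<^sup>2)"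
  shows "ennreal (\<delta>\<^sup>2 * \<rho> powr - \<gamma> * h) * min (emeasure M A) (emeasure M B) \<le> besov_energy M \<gamma> u"
proof -
  let ?k = "ennreal (\<delta>\<^sup>2 * \<rho> powr - \<gamma> * h)"
  have "dominates_balls M \<rho> h A \<or> dominates_balls M \<rho> h B"
  proof (rule connected_dominant_phase[OF conn \<rho> h A B cover ball_ge])
    show False if "dist x y < \<rho>" "ennreal h \<le> emeasure M (A \<inter> ball x \<rho>)"
      "ennreal h \<le> emeasure M (B \<inter> ball y \<rho>)" for x y
      using besov_energy_ge_adjacent_balls[where u = u, OF \<delta> jump \<gamma> h that] small by simp
  qed
  then show ?thesis
  proof
    assume dominant: "dominates_balls M \<rho> h A"
    have "?k * min (emeasure M A) (emeasure M B) \<le> ?k * emeasure M B"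
      by (intro mult_left_mono) auto
    also have "\<dots> \<le> besov_energy M \<gamma> u"
      by (rule besov_energy_ge_dominant_phase[OF \<delta> jump \<gamma> h B dominant])
    finally show ?thesis .
  next
    assume dominant: "dominates_balls M \<rho> h B"
    have "\<delta> \<le> \<bar>u b - u a\<bar>" if "b \<in> B" "a \<in> A" for a b
      using jump[OF that(2,1)] by (simp add: abs_minus_commute)
    note dominated = besov_energy_ge_dominant_phase[OF \<delta> this \<gamma> h A dominant]
    have "?k * min (emeasure M A) (emeasure M B) \<le> ?k * emeasure M A"
      by (intro mult_left_mono) auto
    also have "\<dots> \<le> besov_energy M \<gamma> u" by (rule dominated)
    finally show ?thesis .
  qed
qed

lemma filterlim_at_top_imp_eventually_less_ennreal_mult:
  fixes E m :: ennreal
  assumes f: "filterlim f at_top F" and "E < \<infinity>" "0 < m"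
  shows "\<forall>\<^sub>F x in F. E < m * ennreal (f x)"
proof -
  have "((\<lambda>x. m * ennreal (f x)) \<longlongrightarrow> m * top) F"
  proof (cases "m = top")
    case True
    have "\<forall>\<^sub>F x in F. 0 < f x" using f by (simp add: filterlim_at_top_dense)
    then have "\<forall>\<^sub>F x in F. m * ennreal (f x) = m * top"
      by eventually_elim (simp add: True ennreal_top_mult)
    then show ?thesis by (rule tendsto_eventually)
  next
    case False
    then show ?thesis using f
      by (intro ennreal_tendsto_cmult) (auto simp: less_top ennreal_tendsto_top_eq_at_top)
  qed
  then show ?thesis
    using assms(2,3) by (auto simp: ennreal_mult_top dest!: order_tendstoD(1))
qed

lemma besov_energy_infinite_if_jump:
  fixes M :: "'a::metric_space measure"
  assumes conn: "connected (space M)" and reg: "lower_regular M \<alpha>" and \<alpha>: "0 \<le> \<alpha>" "\<alpha> < \<beta>"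
    and A: "A \<in> sets M" "emeasure M A \<noteq> 0" and B: "B \<in> sets M" "emeasure M B \<noteq> 0"
    and cover: "AE x in M. x \<in> A \<union> B"
    and \<delta>: "0 < \<delta>" and jump: "\<And>a b. a \<in> A \<Longrightarrow> b \<in> B \<Longrightarrow> \<delta> \<le> \<bar>u a - u b\<bar>"
  shows "besov_energy M (\<alpha> + \<beta>) u = \<infinity>"
proof (rule ccontr)
  define E where "E = besov_energy M (\<alpha> + \<beta>) u"
  assume "besov_energy M (\<alpha> + \<beta>) u \<noteq> \<infinity>"
  then have finite: "E < \<infinity>" by (simp add: E_def less_top)
  define m where "m = min (emeasure M A) (emeasure M B)"
  have m: "0 < m" using A B by (simp add: m_def zero_less_iff_neq_zero)
  obtain c D where c: "0 < c" and D: "0 < D"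
    and ball_ge: "\<And>x \<rho>. x \<in> space M \<Longrightarrow> 0 < \<rho> \<Longrightarrow> \<rho> \<le> D \<Longrightarrow>
      ennreal (c * \<rho> powr \<alpha>) \<le> emeasure M (space M \<inter> ball x \<rho>)"
    using reg unfolding lower_regular_def by blast
  define h where "h \<rho> = c / 2 * \<rho> powr \<alpha>" for \<rho>
  have "filterlim (\<lambda>\<rho>. \<delta>\<^sup>2 * (3 * \<rho>) powr - (\<alpha> + \<beta>) * (h \<rho>)\<^sup>2) at_top (at_right 0)"
    unfolding h_def using c \<delta> \<alpha> by real_asymp
  note mixed = filterlim_at_top_imp_eventually_less_ennreal_mult[OF this finite zero_less_one]
  have "filterlim (\<lambda>\<rho>. \<delta>\<^sup>2 * \<rho> powr - (\<alpha> + \<beta>) * h \<rho>) at_top (at_right 0)"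
    unfolding h_def using c \<delta> \<alpha> by real_asymp
  note dominated = filterlim_at_top_imp_eventually_less_ennreal_mult[OF this finite m]
  obtain \<rho> where \<rho>: "0 < \<rho>" "\<rho> \<le> D"
    and less_mixed: "E < ennreal (\<delta>\<^sup>2 * (3 * \<rho>) powr - (\<alpha> + \<beta>) * (h \<rho>)\<^sup>2)"
    and less_dominated: "E < m * ennreal (\<delta>\<^sup>2 * \<rho> powr - (\<alpha> + \<beta>) * h \<rho>)"
    using eventually_happens'[OF trivial_limit_at_right_real eventually_conj[OF
        eventually_at_right_real[OF D] eventually_conj[OF mixed dominated]]]
    by auto
  have h: "0 < h \<rho>" using c \<rho> by (simp add: h_def)
  have "ennreal (\<delta>\<^sup>2 * \<rho> powr - (\<alpha> + \<beta>) * h \<rho>) * m \<le> E"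
    unfolding m_def E_def
  proof (rule besov_energy_ge_two_phases[OF conn \<rho>(1) h A(1) B(1) cover _ \<delta> jump])
    show "ennreal (2 * h \<rho>) \<le> emeasure M (space M \<inter> ball x \<rho>)" if "x \<in> space M" for x
      using ball_ge[OF that \<rho>] by (simp add: h_def)
  qed (use \<alpha> less_mixed in \<open>simp_all add: E_def\<close>)
  then show False using less_dominated by (simp add: mult.commute)
qed

lemma finite_besov_energy_no_gap:
  fixes M :: "'a::metric_space measure"
  assumes conn: "connected (space M)" and reg: "lower_regular M \<alpha>" and \<alpha>: "0 \<le> \<alpha>" "\<alpha> < \<beta>"
    and u[measurable]: "u \<in> borel_measurable M" and finite: "besov_energy M (\<alpha> + \<beta>) u < \<infinity>"
    and less: "s < t" and gap: "AE x in M. \<not> (s < u x \<and> u x < t)"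
  shows "(AE x in M. s < u x) \<or> (AE x in M. u x < t)"
proof (rule ccontr)
  define A where "A = {x\<in>space M. u x \<le> s}"
  define B where "B = {x\<in>space M. t \<le> u x}"
  have meas: "A \<in> sets M" "B \<in> sets M" unfolding A_def B_def by measurable
  assume "\<not> ?thesis"
  then have "emeasure M A \<noteq> 0" "emeasure M B \<noteq> 0"
    using meas by (auto simp: A_def B_def AE_iff_measurable[OF _ refl] not_less not_le)
  moreover have "AE x in M. x \<in> A \<union> B"
    using gap AE_space by eventually_elim (auto simp: A_def B_def)
  moreover have "t - s \<le> \<bar>u a - u b\<bar>" if "a \<in> A" "b \<in> B" for a b
    using that by (auto simp: A_def B_def)
  ultimately have "besov_energy M (\<alpha> + \<beta>) u = \<infinity>"
    using besov_energy_infinite_if_jump[OF conn reg \<alpha> meas(1) _ meas(2), of "t - s" u] less by simp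
  with finite show False by simp
qed

section \<open>Dimension of the Besov spaces\<close>

lemma besov_space_contraction:
  fixes M :: "'a::metric_space measure" and \<phi> :: "real \<Rightarrow> real"
  assumes "finite_measure M" and u: "u \<in> besov_space M \<alpha> \<beta>" and \<phi>: "1-lipschitz_on UNIV \<phi>"
  shows "(\<lambda>x. \<phi> (u x)) \<in> besov_space M \<alpha> \<beta>"
proof -
  interpret finite_measure M by fact
  have [measurable]: "u \<in> borel_measurable M" and square: "integrable M (\<lambda>x. (u x)\<^sup>2)"
    and finite: "besov_energy M (\<alpha> + \<beta>) u < \<infinity>"
    using u by (simp_all add: mem_besov_space_iff)
  have [measurable]: "\<phi> \<in> borel_measurable borel"
    using \<phi> by (intro borel_measurable_continuous_onI lipschitz_on_continuous_on)
  have contraction: "\<bar>\<phi> v - \<phi> w\<bar> \<le> \<bar>v - w\<bar>" for v w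
    using lipschitz_onD[OF \<phi>, of v w] by (simp add: dist_real_def)
  have growth: "(\<phi> v)\<^sup>2 \<le> 2 * (\<phi> 0)\<^sup>2 + 2 * v\<^sup>2" for v
  proof -
    have "(\<phi> v - \<phi> 0)\<^sup>2 \<le> v\<^sup>2" using contraction[of v 0] by (simp add: abs_le_square_iff)
    then show ?thesis
      using zero_le_power2[of "\<phi> v - 2 * \<phi> 0"] by (simp add: power2_eq_square algebra_simps)
  qed
  have "integrable M (\<lambda>x. (\<phi> (u x))\<^sup>2)"
  proof (rule Bochner_Integration.integrable_bound)
    show "integrable M (\<lambda>x. 2 * (\<phi> 0)\<^sup>2 + 2 * (u x)\<^sup>2)" using square by simp
    show "AE x in M. norm ((\<phi> (u x))\<^sup>2) \<le> norm (2 * (\<phi> 0)\<^sup>2 + 2 * (u x)\<^sup>2)"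
      using growth by (intro AE_I2) simp
  qed measurable
  moreover have "besov_energy M (\<alpha> + \<beta>) (\<lambda>x. \<phi> (u x)) \<le> besov_energy M (\<alpha> + \<beta>) u"
    unfolding besov_energy_def using contraction
    by (intro nn_integral_mono ennreal_leI mult_right_mono) (auto simp: abs_le_square_iff)
  ultimately show ?thesis using finite by (simp add: mem_besov_space_iff)
qed

lemma disjoint_supports_imp_ae_independent:
  fixes f :: "'i \<Rightarrow> 'a \<Rightarrow> real"
  assumes "finite I" and disjoint: "\<And>i j x. i \<in> I \<Longrightarrow> j \<in> I \<Longrightarrow> i \<noteq> j \<Longrightarrow> f i x = 0 \<or> f j x = 0"
    and nonnull: "\<And>i. i \<in> I \<Longrightarrow> \<not> (AE x in M. f i x = 0)"
    and dependent: "AE x in M. (\<Sum>i\<in>I. c i * f i x) = 0" and j: "j \<in> I"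
  shows "c j = 0"
proof (rule ccontr)
  assume "c j \<noteq> 0"
  from dependent have "AE x in M. f j x = 0"
  proof eventually_elim
    case (elim x)
    have "(\<Sum>i\<in>I - {j}. c i * f i x * f j x) = 0"
      using disjoint[of _ j x] j by (intro sum.neutral) auto
    then have "c j * f j x * f j x = (\<Sum>i\<in>I. c i * f i x * f j x)"
      using \<open>finite I\<close> j by (simp add: sum.remove)
    also have "\<dots> = (\<Sum>i\<in>I. c i * f i x) * f j x" by (rule sum_distrib_right[symmetric])
    finally show ?case using elim \<open>c j \<noteq> 0\<close> by simp
  qed
  with nonnull[OF j] show False ..
qed

lemma infinite_essential_range_imp_infinite_dimensional:
  assumes M: "finite_measure M" and u: "u \<in> besov_space M \<alpha> \<beta>"
    and infinite: "infinite (essential_range M u)"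
  shows "ae_infinite_dimensional M (besov_space M \<alpha> \<beta>)"
  unfolding ae_infinite_dimensional_def
proof
  fix n :: nat
  obtain V where V: "finite V" "card V = n" "V \<subseteq> essential_range M u"
    using infinite_arbitrarily_large[OF infinite] by blast
  then obtain v where v: "bij_betw v {..<n} V"
    using ex_bij_betw_nat_finite[of V] by (auto simp: lessThan_atLeast0)
  have "uniform_discrete V" using V(1) uniform_discrete_finite_iff by blast
  then obtain e where e: "0 < e" and sep: "\<And>v w. v \<in> V \<Longrightarrow> w \<in> V \<Longrightarrow> dist v w < e \<Longrightarrow> v = w"
    unfolding uniform_discrete_def by blast
  define tent where "tent i y = max 0 (e / 2 - dist y (v i))" for i y
  have "1-lipschitz_on UNIV (tent i)" for i
    by (rule lipschitz_onI) (auto simp: tent_def dist_real_def)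
  then have "(\<lambda>x. tent i (u x)) \<in> besov_space M \<alpha> \<beta>" for i
    by (rule besov_space_contraction[OF M u])
  moreover have "c j = 0" if "AE x in M. (\<Sum>i<n. c i * tent i (u x)) = 0" "j < n" for c j
  proof (rule disjoint_supports_imp_ae_independent[OF finite_lessThan _ _ that(1)])
    fix i k x assume ik: "i \<in> {..<n}" "k \<in> {..<n}" "i \<noteq> k"
    then have "v i \<in> V" "v k \<in> V" "v i \<noteq> v k"
      using v by (auto simp: bij_betw_def inj_on_def)
    then have "e \<le> dist (v i) (v k)" using sep not_less by blast
    then show "tent i (u x) = 0 \<or> tent k (u x) = 0"
      using dist_triangle2[of "v i" "v k" "u x"] by (auto simp: tent_def dist_commute)
  next
    fix i assume "i \<in> {..<n}"
    then have "v i \<in> essential_range M u" using v V(3) by (auto simp: bij_betw_def)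
    then have "\<not> (AE x in M. u x \<notin> ball (v i) (e / 2))"
      using e by (intro essential_rangeD) auto
    moreover have "tent i (u x) = 0 \<longleftrightarrow> u x \<notin> ball (v i) (e / 2)" for x
      by (auto simp: tent_def dist_commute max_def)
    ultimately show "\<not> (AE x in M. tent i (u x) = 0)" by simp
  qed (use that(2) in auto)
  ultimately show "\<exists>f. (\<forall>i<n. f i \<in> besov_space M \<alpha> \<beta>) \<and>
      (\<forall>c. (AE x in M. (\<Sum>i<n. c i * f i x) = 0) \<longrightarrow> (\<forall>i<n. c i = 0))"
    by (intro exI[of _ "\<lambda>i x. tent i (u x)"]) blast
qed

lemma besov_space_nonconstant_imp_infinite_dimensional:
  fixes M :: "'a::metric_space measure"
  assumes M: "finite_measure M" and conn: "connected (space M)" and reg: "lower_regular M \<alpha>"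
    and \<alpha>: "0 \<le> \<alpha>" "\<alpha> < \<beta>" and nonconstant: "ae_has_nonconstant M (besov_space M \<alpha> \<beta>)"
  shows "ae_infinite_dimensional M (besov_space M \<alpha> \<beta>)"
proof -
  obtain u where u: "u \<in> besov_space M \<alpha> \<beta>" and "\<forall>c. \<not> (AE x in M. u x = c)"
    using nonconstant unfolding ae_has_nonconstant_def by blast
  then obtain v w where vw: "v \<in> essential_range M u" "w \<in> essential_range M u" "v < w"
    by (metis nonconstant_imp_essential_range_distinct linorder_neq_iff)
  have "is_interval (essential_range M u)"
    using finite_besov_energy_no_gap[OF conn reg \<alpha>] u
    by (intro is_interval_essential_range) (auto simp: mem_besov_space_iff)
  then have "{v..w} \<subseteq> essential_range M u"
    using vw unfolding is_interval_1 by (meson atLeastAtMost_iff subsetI)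
  then have "infinite (essential_range M u)"
    using infinite_Icc[OF vw(3)] finite_subset by blast
  then show ?thesis by (rule infinite_essential_range_imp_infinite_dimensional[OF M u])
qed

lemma self_similar_besov_space_nonconstant_imp_infinite_dimensional:
  fixes S :: "nat \<Rightarrow> 'a::metric_space \<Rightarrow> 'a" and \<alpha> :: real and K :: "'a set"
  defines "\<nu> \<equiv> normalized_hausdorff \<alpha> K"
  assumes S: "\<forall>i<N. 0 < r i \<and> r i < 1 \<and> similitude (S i) (r i)"
    and K: "self_similar_set N S K" and conn: "connected K" and \<alpha>: "0 \<le> \<alpha>" "\<alpha> < \<beta>"
    and nonconstant: "ae_has_nonconstant \<nu> (besov_space \<nu> \<alpha> \<beta>)"
  shows "ae_infinite_dimensional \<nu> (besov_space \<nu> \<alpha> \<beta>)"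
proof -
  have space: "space \<nu> = K" by (simp add: \<nu>_def space_normalized_hausdorff)
  have nonnull: "emeasure \<nu> K \<noteq> 0"
  proof
    assume "emeasure \<nu> K = 0"
    then have "K \<in> null_sets \<nu>" using sets.top[of \<nu>] space by (simp add: null_sets_def)
    then have "AE x in \<nu>. u x = 0" for u :: "'a \<Rightarrow> real" using space by (intro AE_I') auto
    with nonconstant show False unfolding ae_has_nonconstant_def by blast
  qed
  interpret prob_space \<nu>
    using prob_space_normalized_hausdorff nonnull unfolding \<nu>_def .
  have "lower_regular \<nu> \<alpha>"
    using lower_regular_normalized_hausdorff[OF S K \<alpha>(1)] nonnull unfolding \<nu>_def .
  then show ?thesis
    using conn \<alpha> nonconstant
    by (intro besov_space_nonconstant_imp_infinite_dimensional[OF finite_measure_axioms])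
      (simp_all add: space)
qed

lemma ae_infinite_dimensional_imp_nonconstant:
  assumes "ae_infinite_dimensional M D"
  shows "ae_has_nonconstant M D"
proof (rule ccontr)
  assume "\<not> ?thesis"
  then have const: "\<exists>a. AE x in M. u x = a" if "u \<in> D" for u
    using that by (auto simp: ae_has_nonconstant_def)
  obtain u :: "nat \<Rightarrow> 'a \<Rightarrow> real" where u: "\<forall>i<2. u i \<in> D"
    and independent: "\<And>c. (AE x in M. (\<Sum>i<2. c i * u i x) = 0) \<Longrightarrow> (\<forall>i<2::nat. c i = 0)"
    using assms unfolding ae_infinite_dimensional_def by blast
  obtain a b where a: "AE x in M. u 0 x = a" and b: "AE x in M. u 1 x = b"
    using const[of "u 0"] const[of "u 1"] u by auto
  have relation: "c 0 = 0 \<and> c 1 = 0" if "c 0 * a + c 1 * b = 0" for c :: "nat \<Rightarrow> real"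
  proof -
    have "AE x in M. (\<Sum>i<2. c i * u i x) = 0"
      using a b by eventually_elim (use that in \<open>simp add: numeral_2_eq_2\<close>)
    from independent[OF this] show ?thesis by simp
  qed
  have "a = 0" "b = 0" using relation[of "\<lambda>i. if i = 0 then b else - a"] by simp_all
  then show False using relation[of "\<lambda>_. 1"] by simp
qed

lemma beta2_star_eq_beta3_star:
  assumes upgrade: "\<And>\<beta>. \<alpha> < \<beta> \<Longrightarrow> ae_has_nonconstant M (besov_space M \<alpha> \<beta>) \<Longrightarrow>
      ae_infinite_dimensional M (besov_space M \<alpha> \<beta>)"
    and \<alpha>: "0 \<le> \<alpha>" and exists_nonconstant: "\<exists>\<beta>>\<alpha>. ae_has_nonconstant M (besov_space M \<alpha> \<beta>)"
  shows "beta2_star M \<alpha> = beta3_star M \<alpha>"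
proof (rule antisym)
  show "beta2_star M \<alpha> \<le> beta3_star M \<alpha>"
    unfolding beta2_star_def beta3_star_def
    by (intro Sup_subset_mono image_mono) (auto intro: ae_infinite_dimensional_imp_nonconstant)
  have le_beta2_star: "ereal \<beta> \<le> beta2_star M \<alpha>"
    if "\<alpha> < \<beta>" "ae_has_nonconstant M (besov_space M \<alpha> \<beta>)" for \<beta>
    unfolding beta2_star_def using that \<alpha> upgrade by (auto intro!: Sup_upper)
  obtain \<beta>\<^sub>0 where "\<alpha> < \<beta>\<^sub>0" and "ereal \<beta>\<^sub>0 \<le> beta2_star M \<alpha>"
    using exists_nonconstant le_beta2_star by blast
  then have "ereal \<beta> \<le> beta2_star M \<alpha>" if "\<beta> \<le> \<alpha>" for \<beta>
    using that by (meson ereal_less_eq(3) less_imp_le order_trans)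
  with le_beta2_star show "beta3_star M \<alpha> \<le> beta2_star M \<alpha>"
    unfolding beta3_star_def by (intro Sup_least) (use not_le in blast)
qed

lemma similarity_dimension_pos:
  fixes r :: "nat \<Rightarrow> real"
  assumes "N \<ge> 2" and r: "\<forall>i<N. 0 < r i \<and> r i < 1" and sum: "(\<Sum>i<N. r i powr s) = 1"
  shows "0 < s"
proof (rule ccontr)
  assume "\<not> 0 < s"
  then have "1 \<le> r i powr s" if "i < N" for i
    using r that powr_mono'[of s 0 "r i"] by auto
  then have "real (card {..<N}) * 1 \<le> (\<Sum>i<N. r i powr s)"
    by (intro sum_bounded_below) auto
  then show False using \<open>N \<ge> 2\<close> sum by simp
qed

theorem theorem4p6:
  fixes N :: nat and S :: "nat \<Rightarrow> 'a::euclidean_space \<Rightarrow> 'a" and r :: "nat \<Rightarrow> real"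
    and K :: "'a set" and \<alpha> :: real
  assumes "N \<ge> 2"
    and "\<forall>i<N. 0 < r i \<and> r i < 1 \<and> similitude (S i) (r i)"
    and "open_set_condition N S"
    and "self_similar_set N S K"
    and "(\<Sum>i<N. r i powr \<alpha>) = 1"
    and "connected K"
    and "\<exists>\<beta>>\<alpha>. ae_has_nonconstant (normalized_hausdorff \<alpha> K) (besov_space (normalized_hausdorff \<alpha> K) \<alpha> \<beta>)"
  shows "beta2_star (normalized_hausdorff \<alpha> K) \<alpha> = beta3_star (normalized_hausdorff \<alpha> K) \<alpha>"
proof (rule beta2_star_eq_beta3_star)
  show \<alpha>: "0 \<le> \<alpha>"
    using similarity_dimension_pos[OF assms(1) _ assms(5)] assms(2) by auto
  fix \<beta>
  let ?\<nu> = "normalized_hausdorff \<alpha> K"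
  assume "\<alpha> < \<beta>" "ae_has_nonconstant ?\<nu> (besov_space ?\<nu> \<alpha> \<beta>)"
  then show "ae_infinite_dimensional ?\<nu> (besov_space ?\<nu> \<alpha> \<beta>)"
    by (rule self_similar_besov_space_nonconstant_imp_infinite_dimensional[OF assms(2,4,6) \<alpha>])
qed (rule assms(7))

end
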